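(* There exists a constant $c_0>0$ such that for every integer $n\geq 1$, every real matrix with $64n^4$ rows and $2^{c_0n^4(\log n)^2}$ columns contains an $n\times n$ monotone submatrix.
   Context: An $n\times n$ submatrix of a real matrix $A$ is obtained by choosing row indices $i_1<\dots<i_n$ and column indices $j_1<\dots<j_n$ and taking $B(k,l)=A(i_k,j_l)$. A finite sequence of reals is monotone if it is non-decreasing or non-increasing. A matrix is monotone if every row is monotone with all rows of the same type (all non-decreasing or all non-increasing), and every column is monotone with all columns of the same type. *)

theory Defs
  imports Complex_Main "Jordan_Normal_Form.DL_Submatrix"
begin

definition monotone_mat :: "real mat \<Rightarrow> bool" where
  "monotone_mat B \<longleftrightarrow>
     ((\<forall>i < dim_row B. mono_on {..<dim_col B} (\<lambda>j. B $$ (i, j))) \<or>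
      (\<forall>i < dim_row B. antimono_on {..<dim_col B} (\<lambda>j. B $$ (i, j)))) \<and>
     ((\<forall>j < dim_col B. mono_on {..<dim_row B} (\<lambda>i. B $$ (i, j))) \<or>
      (\<forall>j < dim_col B. antimono_on {..<dim_row B} (\<lambda>i. B $$ (i, j))))"

text \<open>The function \<^const>\<open>submatrix\<close> enumerates both index sets in increasing order, so
  an \<open>n \<times> n\<close> submatrix is one taken along index sets of size \<open>n\<close> lying within the
  dimensions of the matrix.\<close>

definition has_monotone_submatrix :: "nat \<Rightarrow> real mat \<Rightarrow> bool" where
  "has_monotone_submatrix n A \<longleftrightarrow>
     (\<exists>I J. I \<subseteq> {..<dim_row A} \<and> card I = n \<and> J \<subseteq> {..<dim_col A} \<and> card J = n \<and>
            monotone_mat (submatrix A I J))"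

end

theory Submission
  imports Defs
begin

text \<open>
  There are at most \<open>m ^ m\<close> ways in which a column orders the \<open>m = 64 n ^ 4\<close> rows, so many columns
  order them alike; by Erdos--Szekeres these columns are monotone on \<open>8 n\<^sup>2\<close> common rows. It remains
  to find \<open>n\<close> of \<open>R = 8 n\<^sup>2\<close> rows and \<open>n\<close> columns on which the rows are monotone.

  At the cost of a factor \<open>2 ^ (R + 1)\<close>, a set of columns contains two subsets, one to the left of
  the other, whose values are separated in each row; the directions of separation form a sign vector.
  Iterating \<open>D\<close> times gives a binary tree of depth \<open>D\<close>. A Sauer--Shelah count produces, from
  \<open>D = O (R T)\<close> levels, a subtree with \<open>T\<close> levels on each of which the sign vector is constant.
  If \<open>T\<close> is of order \<open>(log n)\<^sup>2\<close>, a convexity argument finds about \<open>log n\<close> of the levels whose sign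
  vectors agree on \<open>n\<close> rows, and the \<open>n\<close> leaves of that subtree are the required columns.
\<close>

subsection \<open>Monotone subsequences\<close>

text \<open>\<open>h i\<close> is the largest size of an \<open>r\<close>-chain whose last index is
  \<open>i\<close>; appending a later \<open>j\<close> with \<open>r (f i) (f j)\<close> gives a
  longer chain ending at \<open>j\<close>. A general \<open>r\<close> covers both directions of
  monotonicity.\<close>

lemma chain_height:
  fixes f :: "nat \<Rightarrow> 'a"
  assumes "reflp r" "transp r"
  shows "\<exists>h::nat \<Rightarrow> nat.
           (\<forall>i. \<exists>S\<subseteq>{..i}. i \<in> S \<and> card S = h i \<and> monotone_on S (\<le>) r f) \<and>
           (\<forall>i j. i < j \<longrightarrow> r (f i) (f j) \<longrightarrow> h i < h j)"
proof -
  define C where "C i = {S. S \<subseteq> {..i} \<and> i \<in> S \<and> monotone_on S (\<le>) r f}" for i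
  have fin: "finite (C i)" for i
    by (rule finite_subset[of _ "Pow {..i}"]) (auto simp: C_def)
  have "{i} \<in> C i" for i
    using assms(1) by (auto simp: C_def monotone_on_def reflp_def)
  then have ne: "card ` C i \<noteq> {}" for i by blast
  define h where "h i = Max (card ` C i)" for i
  have h: "\<exists>S\<in>C i. card S = h i" for i
    using Max_in[of "card ` C i"] fin ne unfolding h_def by (metis finite_imageI imageE)
  have "h i < h j" if "i < j" "r (f i) (f j)" for i j
  proof -
    obtain S where S: "S \<in> C i" "card S = h i" using h by blast
    have "insert j S \<in> C j"
    proof -
      have S': "S \<subseteq> {..i}" "i \<in> S" "monotone_on S (\<le>) r f" using S(1) by (auto simp: C_def)
      have "monotone_on (insert j S) (\<le>) r f"
      proof (rule monotone_onI)
        fix x y assume xy: "x \<in> insert j S" "y \<in> insert j S" "x \<le> y"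
        consider "x \<in> S" "y \<in> S" | "x \<in> S" "y = j" | "x = j" "y = j"
          using xy S'(1) \<open>i < j\<close> by fastforce
        then show "r (f x) (f y)"
        proof cases
          case 1
          then show ?thesis using S'(3) xy(3) by (simp add: monotone_onD)
        next
          case 2
          then have "r (f x) (f i)" using S' by (auto intro: monotone_onD)
          then show ?thesis using 2 that(2) assms(2) by (auto dest: transpD)
        next
          case 3
          then show ?thesis using assms(1) by (simp add: reflpD)
        qed
      qed
      then show ?thesis using S'(1) \<open>i < j\<close> unfolding C_def by fastforce
    qed
    then have "card (insert j S) \<le> h j"
      unfolding h_def using fin by (intro Max_ge) auto
    moreover have "j \<notin> S" "finite S"
      using S(1) that finite_subset by (auto simp: C_def)
    ultimately show ?thesis using S(2) by simp
  qed
  moreover have "\<exists>S\<subseteq>{..i}. i \<in> S \<and> card S = h i \<and> monotone_on S (\<le>) r f" for i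
    using h[of i] unfolding C_def by blast
  ultimately show ?thesis by blast
qed

text \<open>Pigeonhole on the pairs of sizes of the longest non-decreasing and the longest
  non-increasing chain ending at \<open>i\<close>. Of two indices, the later has some larger
  coordinate, so the pairs are distinct; without long chains only \<open>a * b\<close> pairs are
  available.\<close>

lemma erdos_szekeres:
  fixes f :: "nat \<Rightarrow> 'a::linorder"
  assumes "a * b < m"
  shows "(\<exists>S\<subseteq>{..<m}. card S = Suc a \<and> mono_on S f) \<or>
         (\<exists>S\<subseteq>{..<m}. card S = Suc b \<and> antimono_on S f)"
proof (rule ccontr)
  assume neg: "\<not> ?thesis"
  obtain h where h: "\<And>i. \<exists>S\<subseteq>{..i}. i \<in> S \<and> card S = h i \<and> mono_on S f"
    "\<And>i j. i < j \<Longrightarrow> f i \<le> f j \<Longrightarrow> h i < h j"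
    using chain_height[of "(\<le>)" f] by auto
  obtain g where g: "\<And>i. \<exists>S\<subseteq>{..i}. i \<in> S \<and> card S = g i \<and> antimono_on S f"
    "\<And>i j. i < j \<Longrightarrow> f j \<le> f i \<Longrightarrow> g i < g j"
    using chain_height[of "\<lambda>x y. y \<le> x" f] by (auto simp: reflp_def transp_def)
  \<comment> \<open>A general relation lets this serve both coordinates; an overlong chain is cut
    down to exactly \<open>Suc n\<close> indices.\<close>
  have bound: "c i \<in> {1..n}"
    if no: "\<not> (\<exists>S\<subseteq>{..<m}. card S = Suc n \<and> monotone_on S (\<le>) r f)"
      and ex: "\<exists>S\<subseteq>{..i}. i \<in> S \<and> card S = c i \<and> monotone_on S (\<le>) r f"
      and im: "i < m"
    for r :: "'a \<Rightarrow> 'a \<Rightarrow> bool" and c :: "nat \<Rightarrow> nat" and i n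
  proof -
    obtain S where S: "S \<subseteq> {..i}" "i \<in> S" "card S = c i" "monotone_on S (\<le>) r f"
      using ex by blast
    have "finite S" using S(1) finite_subset by blast
    then have "c i \<noteq> 0" using S(2) by (simp flip: S(3)) blast
    moreover have "c i \<le> n"
    proof (rule ccontr)
      assume "\<not> c i \<le> n"
      then obtain T where "T \<subseteq> S" "card T = Suc n"
        using obtain_subset_with_card_n[of "Suc n" S] S(3) by auto
      moreover have "T \<subseteq> {..<m}" using \<open>T \<subseteq> S\<close> S(1) im by fastforce
      ultimately show False using no S(4) monotone_on_subset by blast
    qed
    ultimately show ?thesis by simp
  qed
  have "(\<lambda>i. (h i, g i)) ` {..<m} \<subseteq> {1..a} \<times> {1..b}"
    using bound[of a "(\<le>)" _ h] bound[of b "\<lambda>x y. y \<le> x" _ g] neg h(1) g(1)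
    by (auto simp del: atLeastAtMost_iff)
  then have "card ((\<lambda>i. (h i, g i)) ` {..<m}) \<le> card ({1..a} \<times> {1..b})"
    by (intro card_mono) auto
  moreover have "inj_on (\<lambda>i. (h i, g i)) {..<m}"
  proof (rule linorder_inj_onI)
    fix i j :: nat assume "i < j"
    then have "h i < h j \<or> g i < g j" using h(2)[of i j] g(2)[of i j] linear[of "f i" "f j"] by blast
    then show "(h i, g i) \<noteq> (h j, g j)" by auto
  qed auto
  ultimately show False using assms by (simp add: card_image card_cartesian_product)
qed

subsection \<open>Separating two sets of columns in every row\<close>

text \<open>\<open>L\<close> grows by a minimiser of \<open>f\<close> on what remains; ties are
  broken arbitrarily.\<close>

lemma lower_part:
  fixes f :: "'a \<Rightarrow> 'b::linorder"
  assumes "finite X" "m \<le> card X"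
  shows "\<exists>L\<subseteq>X. card L = m \<and> (\<forall>p\<in>L. \<forall>q\<in>X - L. f p \<le> f q)"
  using assms(2)
proof (induction m)
  case 0
  then show ?case by (intro exI[of _ "{}"]) auto
next
  case (Suc m)
  then obtain L where L: "L \<subseteq> X" "card L = m" "\<forall>p\<in>L. \<forall>q\<in>X - L. f p \<le> f q" by auto
  have finL: "finite L" using L(1) assms(1) finite_subset by blast
  have "X - L \<noteq> {}" using L(2) Suc.prems finL card_mono[of L X] by force
  then have "Min (f ` (X - L)) \<in> f ` (X - L)" using assms(1) by (intro Min_in) auto
  then obtain x where x: "x \<in> X - L" "f x = Min (f ` (X - L))" by auto
  then have "f x \<le> f q" if "q \<in> X - L" for q using that assms(1) by auto
  then show ?case
    using L x(1) finL by (intro exI[of _ "insert x L"]) auto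
qed

text \<open>Cut \<open>P\<close> and \<open>Q\<close> into a lower part of size \<open>m\<close> and
  an upper rest. Either the lower part of \<open>P\<close> lies below the upper part of
  \<open>Q\<close>, or a single violating pair forces the lower part of \<open>Q\<close> below the
  upper part of \<open>P\<close>.\<close>

lemma separate_halves:
  fixes f :: "'a \<Rightarrow> 'b::linorder"
  assumes "finite P" "finite Q" "2 * m \<le> card P" "2 * m \<le> card Q"
  shows "\<exists>P'\<subseteq>P. \<exists>Q'\<subseteq>Q. m \<le> card P' \<and> m \<le> card Q' \<and>
           ((\<forall>p\<in>P'. \<forall>q\<in>Q'. f p \<le> f q) \<or> (\<forall>p\<in>P'. \<forall>q\<in>Q'. f q \<le> f p))"
proof -
  obtain L where L: "L \<subseteq> P" "card L = m" "\<forall>p\<in>L. \<forall>q\<in>P - L. f p \<le> f q"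
    using lower_part[of P m f] assms by auto
  obtain M where M: "M \<subseteq> Q" "card M = m" "\<forall>p\<in>M. \<forall>q\<in>Q - M. f p \<le> f q"
    using lower_part[of Q m f] assms by auto
  have up: "m \<le> card (P - L)" "m \<le> card (Q - M)"
    using assms L M by (auto simp: card_Diff_subset finite_subset)
  show ?thesis
  proof (cases "\<forall>p\<in>L. \<forall>q\<in>Q - M. f p \<le> f q")
    case True
    then show ?thesis using L M up by (intro exI[of _ L] conjI exI[of _ "Q - M"]) auto
  next
    case False
    then obtain p q where pq: "p \<in> L" "q \<in> Q - M" "f q < f p" by (auto simp: not_le)
    have "f y \<le> f x" if "x \<in> P - L" "y \<in> M" for x y
    proof -
      have "f y \<le> f q" using M pq that by blast
      also have "f q \<le> f p" using pq by simp
      also have "f p \<le> f x" using L pq that by blast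
      finally show ?thesis .
    qed
    then show ?thesis using L M up by (intro exI[of _ "P - L"] conjI exI[of _ M]) auto
  qed
qed

text \<open>A sign vector is encoded as the set \<open>s\<close> of its positive rows, so the labels
  are the members of \<open>Pow I\<close>. Equal entries fit either sign.\<close>

definition sign_pattern :: "'i set \<Rightarrow> ('i \<Rightarrow> nat \<Rightarrow> 'b::linorder) \<Rightarrow> 'i set \<Rightarrow> nat \<Rightarrow> nat \<Rightarrow> bool" where
  "sign_pattern I A s a b \<longleftrightarrow> (\<forall>i\<in>I. if i \<in> s then A i a \<le> A i b else A i b \<le> A i a)"

text \<open>Rows are treated one at a time, each costing a factor 2 in both sets; a separation once
  obtained passes to subsets.\<close>

lemma separate_all:
  fixes A :: "'i \<Rightarrow> nat \<Rightarrow> 'b::linorder"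
  assumes "finite I" "finite P" "finite Q" "2 ^ card I * m \<le> card P" "2 ^ card I * m \<le> card Q"
  shows "\<exists>P'\<subseteq>P. \<exists>Q'\<subseteq>Q. \<exists>s\<subseteq>I. m \<le> card P' \<and> m \<le> card Q' \<and>
           (\<forall>a\<in>P'. \<forall>b\<in>Q'. sign_pattern I A s a b)"
  using assms
proof (induction I arbitrary: P Q rule: finite_induct)
  case empty
  then show ?case by (intro exI[of _ P] conjI exI[of _ Q] exI[of _ "{}"]) (auto simp: sign_pattern_def)
next
  case (insert x F)
  then obtain P1 Q1 where 1: "P1 \<subseteq> P" "Q1 \<subseteq> Q" "2 ^ card F * m \<le> card P1" "2 ^ card F * m \<le> card Q1"
    "(\<forall>p\<in>P1. \<forall>q\<in>Q1. A x p \<le> A x q) \<or> (\<forall>p\<in>P1. \<forall>q\<in>Q1. A x q \<le> A x p)"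
    using separate_halves[of P Q "2 ^ card F * m" "A x"] by (auto simp: mult.assoc)
  have "finite P1" "finite Q1" using 1 insert.prems finite_subset by auto
  from insert.IH[OF this 1(3,4)] obtain P' Q' s where 2: "P' \<subseteq> P1" "Q' \<subseteq> Q1" "s \<subseteq> F"
    "m \<le> card P'" "m \<le> card Q'" "\<forall>a\<in>P'. \<forall>b\<in>Q'. sign_pattern F A s a b"
    by auto
  define s' where "s' = (if \<forall>p\<in>P1. \<forall>q\<in>Q1. A x p \<le> A x q then insert x s else s)"
  have "sign_pattern (insert x F) A s' a b" if "a \<in> P'" "b \<in> Q'" for a b
  proof -
    have "x \<notin> s" using 2 insert.hyps by blast
    then have "if x \<in> s' then A x a \<le> A x b else A x b \<le> A x a"
      using 1(5) subsetD[OF 2(1) that(1)] subsetD[OF 2(2) that(2)] unfolding s'_def by auto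
    moreover have "i \<in> s' \<longleftrightarrow> i \<in> s" if "i \<in> F" for i
      using that insert.hyps by (auto simp: s'_def)
    ultimately show ?thesis using 2(6) that by (auto simp: sign_pattern_def)
  qed
  moreover have "s' \<subseteq> insert x F" using 2 by (auto simp: s'_def)
  ultimately show ?case using 1 2
    by (intro exI[of _ P'] conjI exI[of _ Q'] exI[of _ s']) auto
qed

text \<open>The extra factor 2 pays for first cutting \<open>X\<close> by position, through
  \<open>lower_part\<close> for \<open>id\<close>, into left and right columns.\<close>

lemma separated_pair:
  fixes A :: "'i \<Rightarrow> nat \<Rightarrow> 'b::linorder"
  assumes "finite I" "finite X" "2 ^ (card I + 1) * m \<le> card X"
  shows "\<exists>L\<subseteq>X. \<exists>R\<subseteq>X. \<exists>s\<subseteq>I. m \<le> card L \<and> m \<le> card R \<and>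
           (\<forall>a\<in>L. \<forall>b\<in>R. a < b \<and> sign_pattern I A s a b)"
proof -
  obtain L where L: "L \<subseteq> X" "card L = 2 ^ card I * m" "\<forall>p\<in>L. \<forall>q\<in>X - L. p \<le> q"
    using lower_part[of X "2 ^ card I * m" id] assms by auto
  have "2 ^ card I * m \<le> card (X - L)"
    using assms L by (auto simp: card_Diff_subset finite_subset)
  then obtain P Q s where "P \<subseteq> L" "Q \<subseteq> X - L" "s \<subseteq> I" "m \<le> card P" "m \<le> card Q"
    "\<forall>a\<in>P. \<forall>b\<in>Q. sign_pattern I A s a b"
    using separate_all[of I L "X - L" m A] assms L finite_subset by (metis finite_Diff order_refl)
  moreover have "a < b" if "a \<in> L" "b \<in> X - L" for a b
    using L(3) that by (metis DiffD2 le_neq_implies_less)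
  ultimately have "P \<subseteq> X" "Q \<subseteq> X" "\<forall>a\<in>P. \<forall>b\<in>Q. a < b \<and> sign_pattern I A s a b"
    using L(1) by blast+
  then show ?thesis using \<open>s \<subseteq> I\<close> \<open>m \<le> card P\<close> \<open>m \<le> card Q\<close> by blast
qed

subsection \<open>Level-homogeneous binary trees\<close>

text \<open>A binary tree with leaves in \<open>X\<close>; all splits on one level carry the same label.\<close>

fun split_tree :: "('s \<Rightarrow> nat \<Rightarrow> nat \<Rightarrow> bool) \<Rightarrow> 's list \<Rightarrow> nat set \<Rightarrow> bool" where
  "split_tree E [] X \<longleftrightarrow> X \<noteq> {}"
| "split_tree E (s # ls) X \<longleftrightarrow>
     (\<exists>L\<subseteq>X. \<exists>R\<subseteq>X. split_tree E ls L \<and> split_tree E ls R \<and> (\<forall>a\<in>L. \<forall>b\<in>R. a < b \<and> E s a b))"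

lemma split_tree_mono: "split_tree E ls X \<Longrightarrow> X \<subseteq> Y \<Longrightarrow> split_tree E ls Y"
proof (cases ls)
  case (Cons s ls')
  assume "split_tree E ls X" "X \<subseteq> Y"
  then show ?thesis unfolding Cons split_tree.simps by (meson subset_trans)
qed auto

text \<open>A level is dropped by replacing each split on it by one of its two subtrees.\<close>

lemma split_tree_nths: "split_tree E ls X \<Longrightarrow> split_tree E (nths ls K) X"
proof (induction ls arbitrary: X K)
  case (Cons s ls)
  then obtain L R where LR: "L \<subseteq> X" "R \<subseteq> X" "split_tree E ls L" "split_tree E ls R"
    "\<forall>a\<in>L. \<forall>b\<in>R. a < b \<and> E s a b"
    by auto
  have *: "split_tree E (nths ls {j. Suc j \<in> K}) L" "split_tree E (nths ls {j. Suc j \<in> K}) R"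
    using Cons.IH LR by auto
  show ?case
  proof (cases "0 \<in> K")
    case True
    then show ?thesis using * LR by (auto simp: nths_Cons)
  next
    case False
    then show ?thesis using * LR split_tree_mono by (auto simp: nths_Cons)
  qed
qed auto

text \<open>Two leaves part at exactly one split, the smaller one going left, so whatever all labels
  imply holds for every pair of leaves. Each level doubles their number.\<close>

lemma split_tree_leaves:
  assumes "split_tree E ls X" "\<And>s a b. s \<in> set ls \<Longrightarrow> E s a b \<Longrightarrow> Q a b"
  shows "\<exists>J\<subseteq>X. finite J \<and> card J = 2 ^ length ls \<and> (\<forall>a\<in>J. \<forall>b\<in>J. a < b \<longrightarrow> Q a b)"
  using assms
proof (induction ls arbitrary: X)
  case Nil
  then obtain x where "x \<in> X" by auto
  then show ?case by (intro exI[of _ "{x}"]) auto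
next
  case (Cons s ls)
  then obtain L R where LR: "L \<subseteq> X" "R \<subseteq> X" "split_tree E ls L" "split_tree E ls R"
    "\<forall>a\<in>L. \<forall>b\<in>R. a < b \<and> E s a b"
    by auto
  have Q: "Q a b" if "a \<in> L" "b \<in> R" for a b
    using LR(5) Cons.prems(2)[of s] that by simp
  obtain J where J: "J \<subseteq> L" "finite J" "card J = 2 ^ length ls" "\<forall>a\<in>J. \<forall>b\<in>J. a < b \<longrightarrow> Q a b"
    using Cons.IH[OF LR(3)] Cons.prems(2) by auto
  obtain K where K: "K \<subseteq> R" "finite K" "card K = 2 ^ length ls" "\<forall>a\<in>K. \<forall>b\<in>K. a < b \<longrightarrow> Q a b"
    using Cons.IH[OF LR(4)] Cons.prems(2) by auto
  have lt: "a < b" if "a \<in> J" "b \<in> K" for a b using that J(1) K(1) LR(5) by blast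
  then have "J \<inter> K = {}" by blast
  then have "card (J \<union> K) = 2 ^ length (s # ls)" using J K by (simp add: card_Un_disjoint)
  moreover have "Q a b" if "a \<in> J \<union> K" "b \<in> J \<union> K" "a < b" for a b
  proof -
    consider "a \<in> J" "b \<in> J" | "a \<in> J" "b \<in> K" | "a \<in> K" "b \<in> K"
      using \<open>a \<in> J \<union> K\<close> \<open>b \<in> J \<union> K\<close> lt[of b a] \<open>a < b\<close> by auto
    then show ?thesis using J K Q \<open>a < b\<close> by cases blast+
  qed
  ultimately show ?case using J K LR(1,2) by (intro exI[of _ "J \<union> K"]) auto
qed

text \<open>
  A word of length \<open>D\<close> records, level by level, the label of a split or \<open>None\<close> if the level is
  skipped. Keeping the skipped levels aligns the words of the two halves of \<open>X\<close>, so that a word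
  realised in both halves yields two words for \<open>X\<close>; this is Pajor's form of the Sauer--Shelah lemma.
\<close>

definition level_words :: "'s set \<Rightarrow> nat \<Rightarrow> 's option list set" where
  "level_words Lab D = {w. length w = D \<and> set w \<subseteq> insert None (Some ` Lab)}"

lemma finite_level_words: "finite Lab \<Longrightarrow> finite (level_words Lab D)"
  using finite_lists_length_eq[of "insert None (Some ` Lab)" D]
  by (auto simp: level_words_def elim: rev_finite_subset)

fun labels :: "'s option list \<Rightarrow> 's list" where
  "labels [] = []"
| "labels (None # w) = labels w"
| "labels (Some s # w) = s # labels w"

lemma set_labels: "set (labels w) = {s. Some s \<in> set w}"
  by (induction w rule: labels.induct) auto

text \<open>One split at the top leaves two halves large enough for the remaining levels. Words of
  either half extend by \<open>None\<close>, words of both also by \<open>Some s\<close>; as union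
  and intersection together have as many elements as the two word sets, the count doubles.\<close>

lemma card_realised_words:
  assumes "finite Lab" "finite X" "q ^ D \<le> card X"
    and split: "\<And>X m. finite X \<Longrightarrow> q * m \<le> card X \<Longrightarrow>
      \<exists>L\<subseteq>X. \<exists>R\<subseteq>X. \<exists>s\<in>Lab. m \<le> card L \<and> m \<le> card R \<and> (\<forall>a\<in>L. \<forall>b\<in>R. a < b \<and> E s a b)"
  shows "2 ^ D \<le> card {w \<in> level_words Lab D. split_tree E (labels w) X}"
  using assms(2,3)
proof (induction D arbitrary: X)
  case 0
  \<comment> \<open>Here \<open>q ^ 0 = 1\<close> makes \<open>X\<close> nonempty, so the empty word
    is realised.\<close>
  have "{w \<in> level_words Lab 0. split_tree E (labels w) X} = {[]}"
    using 0 by (auto simp: level_words_def)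
  then show ?case by (simp only: card.insert card.empty) simp
next
  case (Suc D)
  define F where "F D X = {w \<in> level_words Lab D. split_tree E (labels w) X}" for D X
  obtain L R s where LR: "L \<subseteq> X" "R \<subseteq> X" "s \<in> Lab" "q ^ D \<le> card L" "q ^ D \<le> card R"
    "\<forall>a\<in>L. \<forall>b\<in>R. a < b \<and> E s a b"
    using split[of X "q ^ D"] Suc.prems by auto
  have fin: "finite (F D X)" for D X
    unfolding F_def using finite_level_words[OF assms(1)] by simp
  have "2 ^ D \<le> card (F D L)" "2 ^ D \<le> card (F D R)"
    unfolding F_def using LR Suc.prems(1) by (auto intro!: Suc.IH elim: finite_subset)
  then have "2 ^ Suc D \<le> card (F D L) + card (F D R)" by simp
  also have "\<dots> = card (F D L \<union> F D R) + card (F D L \<inter> F D R)"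
    using card_Un_Int fin by blast
  also have "\<dots> = card ((#) None ` (F D L \<union> F D R) \<union> (#) (Some s) ` (F D L \<inter> F D R))"
    using fin by (subst card_Un_disjoint) (auto simp: card_image)
  also have "\<dots> \<le> card (F (Suc D) X)"
  proof (intro card_mono fin subsetI)
    fix w assume "w \<in> (#) None ` (F D L \<union> F D R) \<union> (#) (Some s) ` (F D L \<inter> F D R)"
    then consider v where "w = None # v" "v \<in> F D L \<union> F D R"
      | v where "w = Some s # v" "v \<in> F D L" "v \<in> F D R"
      by blast
    then show "w \<in> F (Suc D) X"
    proof cases
      case 1
      then show ?thesis using LR(1,2) by (auto simp: F_def level_words_def intro: split_tree_mono)
    next
      case (2 v)
      then have "split_tree E (labels v) L" "split_tree E (labels v) R" by (auto simp: F_def)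
      then have "split_tree E (labels w) X" using 2(1) LR(1,2,6) by (simp, blast)
      then show ?thesis using 2 LR(3) by (auto simp: F_def level_words_def)
    qed
  qed
  finally show ?case unfolding F_def .
qed

text \<open>Such a word is determined by filling \<open>t\<close> slots, each either left empty or
  given a level and a label. The induction splits on the first letter.\<close>

lemma card_sparse_words:
  assumes "finite Lab"
  shows "card {w \<in> level_words Lab D. length (labels w) \<le> t} \<le> (1 + D * card Lab) ^ t"
proof (induction D arbitrary: t)
  case 0
  have "{w \<in> level_words Lab 0. length (labels w) \<le> t} \<subseteq> {[]}" by (auto simp: level_words_def)
  then have "card {w \<in> level_words Lab 0. length (labels w) \<le> t} \<le> card {[] :: 'a option list}"
    by (intro card_mono) auto
  then show ?case by simp
next
  case (Suc D)
  define F where "F D t = {w \<in> level_words Lab D. length (labels w) \<le> t}" for D t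
  have fin: "finite (F D t)" for D t
    unfolding F_def using finite_level_words[OF assms] by simp
  have IH: "card (F D t) \<le> (1 + D * card Lab) ^ t" for t unfolding F_def by (rule Suc.IH)
  show ?case
  proof (cases t)
    case 0
    have "F (Suc D) 0 \<subseteq> (#) None ` F D 0"
    proof
      fix w assume w: "w \<in> F (Suc D) 0"
      then obtain x v where "w = x # v" by (cases w) (auto simp: F_def level_words_def)
      then show "w \<in> (#) None ` F D 0" using w by (cases x) (auto simp: F_def level_words_def)
    qed
    then have "card (F (Suc D) 0) \<le> card ((#) None ` F D 0)" using fin by (intro card_mono) auto
    also have "\<dots> = card (F D 0)" by (simp add: card_image)
    finally show ?thesis using IH[of 0] 0 by (simp add: F_def)
  next
    case (Suc u)
    let ?g = "\<lambda>(s, v). Some s # v"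
    have "F (Suc D) t \<subseteq> (#) None ` F D t \<union> ?g ` (Lab \<times> F D u)"
    proof
      fix w assume w: "w \<in> F (Suc D) t"
      then obtain x v where "w = x # v" by (cases w) (auto simp: F_def level_words_def)
      then show "w \<in> (#) None ` F D t \<union> ?g ` (Lab \<times> F D u)"
        using w Suc by (cases x) (auto simp: F_def level_words_def)
    qed
    then have "card (F (Suc D) t) \<le> card ((#) None ` F D t \<union> ?g ` (Lab \<times> F D u))"
      using fin assms by (intro card_mono) auto
    also have "\<dots> \<le> card ((#) None ` F D t) + card (?g ` (Lab \<times> F D u))" by (rule card_Un_le)
    also have "\<dots> \<le> card (F D t) + card (Lab \<times> F D u)"
      using fin assms by (intro add_mono card_image_le) auto
    also have "\<dots> \<le> (1 + D * card Lab) ^ t + card Lab * (1 + D * card Lab) ^ u"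
      using IH by (simp add: card_cartesian_product add_mono)
    also have "\<dots> = (1 + Suc D * card Lab) * (1 + D * card Lab) ^ u"
      by (simp add: Suc algebra_simps)
    also have "\<dots> \<le> (1 + Suc D * card Lab) * (1 + Suc D * card Lab) ^ u"
      by (intro mult_left_mono power_mono) auto
    finally show ?thesis by (simp add: F_def Suc)
  qed
qed

text \<open>More words are realised than there are words with at most \<open>t\<close>
  labels.\<close>

lemma long_split_tree:
  assumes "finite Lab" "finite X" "q ^ D \<le> card X" "(1 + D * card Lab) ^ t < 2 ^ D"
    and split: "\<And>X m. finite X \<Longrightarrow> q * m \<le> card X \<Longrightarrow>
      \<exists>L\<subseteq>X. \<exists>R\<subseteq>X. \<exists>s\<in>Lab. m \<le> card L \<and> m \<le> card R \<and> (\<forall>a\<in>L. \<forall>b\<in>R. a < b \<and> E s a b)"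
  shows "\<exists>ls. set ls \<subseteq> Lab \<and> t < length ls \<and> split_tree E ls X"
proof -
  let ?A = "{w \<in> level_words Lab D. split_tree E (labels w) X}"
  let ?B = "{w \<in> level_words Lab D. length (labels w) \<le> t}"
  have "card ?B < card ?A"
    using card_realised_words[OF assms(1-3) split] card_sparse_words[OF assms(1), of D t] assms(4)
    by linarith
  then have "\<not> ?A \<subseteq> ?B"
    using card_mono[of ?B ?A] finite_level_words[OF assms(1)] by fastforce
  then obtain w where w: "w \<in> level_words Lab D" "split_tree E (labels w) X" "t < length (labels w)"
    unfolding subset_iff by (auto simp: not_le)
  moreover have "set (labels w) \<subseteq> Lab"
    using w(1) by (auto simp: level_words_def set_labels)
  ultimately show ?thesis by blast
qed

subsection \<open>Choosing levels that share many rows\<close>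

text \<open>Bernoulli's inequality for \<open>x / a\<close>, scaled by
  \<open>a ^ Suc k\<close>.\<close>

lemma tangent_line_power:
  fixes x a :: real
  assumes "0 \<le> x" "0 < a"
  shows "a ^ Suc k + Suc k * a ^ k * (x - a) \<le> x ^ Suc k"
proof -
  have "1 + Suc k * (x / a - 1) \<le> (1 + (x / a - 1)) ^ Suc k"
    using assms by (intro Bernoulli_inequality) (simp add: field_simps)
  then have "a ^ Suc k * (1 + Suc k * (x / a - 1)) \<le> a ^ Suc k * (x / a) ^ Suc k"
    using assms by (intro mult_left_mono) auto
  also have "\<dots> = x ^ Suc k" using assms by (simp add: power_divide)
  also have "a ^ Suc k * (1 + Suc k * (x / a - 1)) = a ^ Suc k + Suc k * a ^ k * (x - a)"
    using assms by (simp add: field_simps)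
  finally show ?thesis .
qed

text \<open>The left side is the tangent at \<open>d = a + Suc k\<close> to the power
  \<open>(d - Suc k) ^ Suc k\<close>, which lies below the falling factorial. Being affine in
  \<open>d\<close>, it can be summed when only the total of the \<open>d\<close> is known.\<close>

lemma tangent_line_binomial:
  fixes a :: real
  assumes "0 < a"
  shows "a ^ Suc k + Suc k * a ^ k * (real d - Suc k - a) \<le> fact (Suc k) * (d choose Suc k)"
proof (cases "Suc k \<le> d")
  case True
  have "a ^ Suc k + Suc k * a ^ k * (real d - Suc k - a) \<le> (real d - Suc k) ^ Suc k"
    using True assms by (intro tangent_line_power) auto
  also have "\<dots> = (\<Prod>i = 0..<Suc k. real d - Suc k)" by simp
  also have "\<dots> \<le> (\<Prod>i = 0..<Suc k. real d - real i)"
    using True by (intro prod_mono) auto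
  also have "\<dots> = fact (Suc k) * (real d gchoose Suc k)" by (rule gbinomial_mult_fact[symmetric])
  also have "\<dots> = fact (Suc k) * (d choose Suc k)" 
    by (simp only: binomial_gbinomial of_nat_mult of_nat_fact)
  finally show ?thesis .
next
  case False
  have "a ^ Suc k + Suc k * a ^ k * (real d - Suc k - a) = a ^ k * (a + Suc k * (real d - Suc k - a))"
    by (simp add: algebra_simps)
  also have "\<dots> \<le> a ^ k * 0"
  proof (intro mult_left_mono)
    \<comment> \<open>The bracket is negative, so lowering the factor \<open>Suc k\<close> to 1 only
      increases the product; what remains is \<open>d - Suc k < 0\<close>.\<close>
    have "Suc k * (real d - Suc k - a) \<le> 1 * (real d - Suc k - a)"
      using False assms by (intro mult_right_mono_neg) auto
    then show "a + Suc k * (real d - Suc k - a) \<le> 0" using False by simp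
  qed (use assms in auto)
  also have "a ^ k * 0 = real (fact (Suc k) * (d choose Suc k))"
    using False by (simp add: binomial_eq_0)
  finally show ?thesis .
qed

text \<open>Double counting of pairs of an element \<open>i\<close> and a \<open>k\<close>-subset
  \<open>K\<close> of \<open>P\<close> all of whose sets contain \<open>i\<close>. An element lies
  in at least half of the sets on average, so convexity gives many pairs, too many if every
  \<open>K\<close> had fewer than \<open>n\<close> common elements.\<close>

lemma common_elements:
  fixes s :: "'t \<Rightarrow> 'i set"
  assumes "finite I" "finite P" "0 < k" "card P = 4 * k\<^sup>2" "0 < n" "n * 2 ^ (k + 1) \<le> card I"
    and s: "\<And>t. t \<in> P \<Longrightarrow> s t \<subseteq> I \<and> card I \<le> 2 * card (s t)"
  shows "\<exists>K\<subseteq>P. card K = k \<and> n \<le> card {i\<in>I. \<forall>t\<in>K. i \<in> s t}"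
proof (rule ccontr)
  assume neg: "\<not> ?thesis"
  define d where "d i = card {t\<in>P. i \<in> s t}" for i
  define PK where "PK = {K. K \<subseteq> P \<and> card K = k}"
  define p where "p = real (card P)"
  define a where "a = p / 2 - k"
  have p: "p = 4 * (real k)\<^sup>2" using assms(4) by (simp add: p_def)
  have kk: "real k \<le> (real k)\<^sup>2" "1 \<le> real k" using assms(3) by (auto simp: power2_eq_square)
  have a0: "0 < a" using kk unfolding a_def p by linarith
  obtain k' where k': "k = Suc k'" using assms(3) gr0_conv_Suc by blast
  have finPK: "finite PK" unfolding PK_def using assms(2) by simp
  have cPK: "card PK = card P choose k" unfolding PK_def using n_subsets[OF assms(2)] by simp
  have "k \<le> card P" using assms(3,4) by (simp add: power2_eq_square)
  then have PK0: "0 < card PK" using cPK by simp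

  have "(\<Sum>i\<in>I. d i) = (\<Sum>t\<in>P. card (s t))"
    unfolding d_def
  proof (rule sum_multicount_gen[OF assms(1,2)], intro ballI)
    fix t assume "t \<in> P"
    then have "{i \<in> I. i \<in> s t} = s t" using s by blast
    then show "card {i \<in> I. i \<in> s t} = card (s t)" by simp
  qed
  moreover have "(\<Sum>t\<in>P. card I) \<le> (\<Sum>t\<in>P. 2 * card (s t))" using s by (intro sum_mono) auto
  ultimately have "card P * card I \<le> 2 * (\<Sum>i\<in>I. d i)" by (simp add: sum_distrib_left)
  then have "real (card P * card I) \<le> real (2 * (\<Sum>i\<in>I. d i))" by (rule of_nat_mono)
  then have deg: "p * card I \<le> 2 * (\<Sum>i\<in>I. real (d i))" by (simp add: p_def)

  \<comment> \<open>Convexity of \<open>d \<mapsto> d choose k\<close>, via the tangent at the average degree \<open>p / 2 = a + k\<close>.\<close>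
  have "card I * a ^ k \<le> card I * a ^ k + k * a ^ k' * ((\<Sum>i\<in>I. real (d i)) - card I * (k + a))"
  proof -
    have "0 \<le> (\<Sum>i\<in>I. real (d i)) - card I * (k + a)"
      using deg by (simp add: a_def algebra_simps)
    then show ?thesis using a0 by simp
  qed
  also have "(\<Sum>i\<in>I. real (d i)) - card I * (k + a) = (\<Sum>i\<in>I. real (d i) - k - a)"
    by (simp add: sum_subtractf algebra_simps)
  also have "card I * a ^ k + k * a ^ k' * \<dots> = (\<Sum>i\<in>I. a ^ k + k * a ^ k' * (real (d i) - k - a))"
    by (simp add: sum.distrib sum_distrib_left)
  also have "\<dots> \<le> (\<Sum>i\<in>I. fact k * (d i choose k))"
    unfolding k' of_nat_sum using a0 by (intro sum_mono tangent_line_binomial)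
  also have "\<dots> = fact k * real (\<Sum>i\<in>I. d i choose k)" by (simp add: sum_distrib_left)
  also have "(\<Sum>i\<in>I. d i choose k) = (\<Sum>i\<in>I. card {K\<in>PK. \<forall>t\<in>K. i \<in> s t})"
  proof (rule sum.cong[OF refl])
    fix i
    have "d i choose k = card {K. K \<subseteq> {t\<in>P. i \<in> s t} \<and> card K = k}"
      unfolding d_def using n_subsets[of "{t\<in>P. i \<in> s t}" k] assms(2) by simp
    also have "{K. K \<subseteq> {t\<in>P. i \<in> s t} \<and> card K = k} = {K\<in>PK. \<forall>t\<in>K. i \<in> s t}"
      unfolding PK_def by blast
    finally show "d i choose k = card {K\<in>PK. \<forall>t\<in>K. i \<in> s t}" .
  qed
  \<comment> \<open>The same pairs counted by \<open>K\<close>; each \<open>K\<close> contributes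
    less than \<open>n\<close> by the negated claim.\<close>
  also have "\<dots> = (\<Sum>K\<in>PK. card {i\<in>I. \<forall>t\<in>K. i \<in> s t})"
    by (rule sum_multicount_gen[OF assms(1) finPK]) auto
  also have "fact k * real (\<Sum>K\<in>PK. card {i\<in>I. \<forall>t\<in>K. i \<in> s t}) < fact k * real (\<Sum>K\<in>PK. n)"
  proof -
    have "(\<Sum>K\<in>PK. card {i\<in>I. \<forall>t\<in>K. i \<in> s t}) < (\<Sum>K\<in>PK. n)"
    proof (rule sum_strict_mono[OF finPK])
      show "PK \<noteq> {}" using PK0 by auto
    qed (use neg in \<open>auto simp: PK_def not_le\<close>)
    then show ?thesis by (intro mult_strict_left_mono) (simp_all only: of_nat_less_iff fact_gt_zero)
  qed
  also have "\<dots> = n * (fact k * (card P choose k))" using cPK by simp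
  also have "\<dots> \<le> real (n * card P ^ k)"
    using binomial_fact_pow[of "card P" k] by (intro of_nat_mono mult_le_mono2) (simp add: mult.commute)
  also have "\<dots> = n * p ^ k" by (simp add: p_def)
  finally have *: "card I * a ^ k < n * p ^ k" .

  \<comment> \<open>As \<open>p = 4 * k ^ 2\<close>, subtracting \<open>k\<close> from
    \<open>p / 2\<close> only costs the factor \<open>1 - 1 / (2 * k)\<close>, whose
    \<open>k\<close>-th power is at least 1/2. With the \<open>2 ^ k\<close> from halving
    \<open>p\<close>, this explains the factor \<open>2 ^ (k + 1)\<close> in the hypothesis.\<close>
  have "1 + of_nat k * (- 1 / (2 * real k)) \<le> (1 + (- 1 / (2 * real k))) ^ k"
    using kk by (intro Bernoulli_inequality) (simp add: field_simps)
  then have half: "1 / 2 \<le> (1 - 1 / (2 * real k)) ^ k" using kk by simp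
  have "a = p / 2 * (1 - 1 / (2 * real k))"
    using kk unfolding a_def p by (simp add: field_simps power2_eq_square)
  then have "a ^ k = p ^ k / 2 ^ k * (1 - 1 / (2 * real k)) ^ k"
    by (simp only: power_mult_distrib power_divide)
  also have "\<dots> \<ge> p ^ k / 2 ^ k * (1 / 2)"
    using half by (intro mult_left_mono) (auto simp: p_def)
  finally have "card I * (p ^ k / 2 ^ k * (1 / 2)) \<le> card I * a ^ k"
    by (intro mult_left_mono) auto
  moreover have "real n * 2 ^ (k + 1) * (p ^ k / 2 ^ k * (1 / 2)) \<le> card I * (p ^ k / 2 ^ k * (1 / 2))"
  proof (rule mult_right_mono)
    show "real n * 2 ^ (k + 1) \<le> card I"
      using of_nat_mono[OF assms(6), where 'a = real] by simp
  qed (auto simp: p_def)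
  moreover have "real n * 2 ^ (k + 1) * (p ^ k / 2 ^ k * (1 / 2)) = n * p ^ k" by simp
  ultimately show False using * by linarith
qed

section \<open>Monotone rows from a long split tree\<close>

text \<open>On each level at least half of the rows have the same sign. For \<open>4 * k ^ 2\<close>
  of the levels this majority sign agrees, and \<open>common_elements\<close> picks \<open>k\<close>
  of them that share \<open>n\<close> rows.\<close>

lemma split_tree_monotone_rows:
  fixes A :: "'i \<Rightarrow> nat \<Rightarrow> 'b::linorder"
  assumes "finite I" "split_tree (sign_pattern I A) ls X" "set ls \<subseteq> Pow I" "8 * k\<^sup>2 \<le> length ls"
    and "0 < k" "0 < n" "n * 2 ^ (k + 1) \<le> card I" "n \<le> 2 ^ k"
  shows "\<exists>S\<subseteq>I. \<exists>J\<subseteq>X. card S = n \<and> card J = n \<and>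
           ((\<forall>i\<in>S. mono_on J (A i)) \<or> (\<forall>i\<in>S. antimono_on J (A i)))"
proof -
  \<comment> \<open>One argument for both signs: \<open>s l\<close> is \<open>l\<close> when
    \<open>r\<close> is the order, and \<open>I - l\<close> when \<open>r\<close> is its
    converse.\<close>
  have select: "\<exists>S\<subseteq>I. \<exists>J\<subseteq>X. card S = n \<and> card J = n \<and> (\<forall>i\<in>S. monotone_on J (\<le>) r (A i))"
    if P: "P \<subseteq> {..<length ls}" "4 * k\<^sup>2 \<le> card P"
      and s: "\<And>t. t \<in> P \<Longrightarrow> s (ls ! t) \<subseteq> I \<and> card I \<le> 2 * card (s (ls ! t))"
      and r: "\<And>l a b i. sign_pattern I A l a b \<Longrightarrow> i \<in> I \<Longrightarrow> i \<in> s l \<Longrightarrow> r (A i a) (A i b)"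
      and "reflp r"
    for P and s :: "'i set \<Rightarrow> 'i set" and r
  proof -
    obtain P' where P': "P' \<subseteq> P" "card P' = 4 * k\<^sup>2" "finite P'"
      by (rule obtain_subset_with_card_n[OF P(2)])
    obtain K where K: "K \<subseteq> P'" "card K = k" "n \<le> card {i\<in>I. \<forall>t\<in>K. i \<in> s (ls ! t)}"
      using common_elements[of I P' k n "\<lambda>t. s (ls ! t)"] assms P' s by blast
    obtain S where S: "S \<subseteq> {i\<in>I. \<forall>t\<in>K. i \<in> s (ls ! t)}" "card S = n" "finite S"
      by (rule obtain_subset_with_card_n[OF K(3)])
    have len: "length (nths ls K) = k"
    proof -
      have "{i. i < length ls \<and> i \<in> K} = K" using K(1) P'(1) P(1) by auto
      then show ?thesis using K(2) by (simp add: length_nths)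
    qed
    \<comment> \<open>Only the levels in \<open>K\<close> are kept. Their labels all favour the rows
      in \<open>S\<close>, so the \<open>2 ^ k\<close> leaves are ordered by \<open>r\<close> in
      each of these rows.\<close>
    have "split_tree (sign_pattern I A) (nths ls K) X"
      using assms(2) by (rule split_tree_nths)
    then obtain J where J: "J \<subseteq> X" "card J = 2 ^ k"
      "\<forall>a\<in>J. \<forall>b\<in>J. a < b \<longrightarrow> (\<forall>i\<in>S. r (A i a) (A i b))"
    proof (rule exE[OF split_tree_leaves[where Q = "\<lambda>a b. \<forall>i\<in>S. r (A i a) (A i b)"]])
      fix l a b assume "l \<in> set (nths ls K)" and E: "sign_pattern I A l a b"
      then obtain t where "t \<in> K" "l = ls ! t" by (auto simp: set_nths)
      then show "\<forall>i\<in>S. r (A i a) (A i b)" using S(1) r[OF E] by auto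
    qed (use len in auto)
    have "n \<le> card J" using assms(8) J(2) by simp
    then obtain J' where J': "J' \<subseteq> J" "card J' = n" "finite J'"
      by (rule obtain_subset_with_card_n)
    have "monotone_on J' (\<le>) r (A i)" if "i \<in> S" for i
    proof (rule monotone_onI)
      fix a b assume ab: "a \<in> J'" "b \<in> J'" "a \<le> b"
      show "r (A i a) (A i b)"
      proof (cases "a = b")
        case True
        then show ?thesis using \<open>reflp r\<close> by (simp add: reflpD)
      next
        case False
        then have "a \<in> J" "b \<in> J" "a < b" using ab J'(1) by auto
        then show ?thesis using J(3) that by blast
      qed
    qed
    then show ?thesis using S J(1) J' by (intro exI[of _ S] conjI exI[of _ J']) auto
  qed
  have sub: "ls ! t \<subseteq> I" if "t < length ls" for t using that assms(3) nth_mem by blast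
  let ?P = "{t. t < length ls \<and> card I \<le> 2 * card (ls ! t)}"
  let ?N = "{t. t < length ls \<and> \<not> card I \<le> 2 * card (ls ! t)}"
  have "?P \<union> ?N = {..<length ls}" "?P \<inter> ?N = {}" by auto
  then have "card ?P + card ?N = length ls" using card_Un_disjoint[of ?P ?N] by simp
  then consider "4 * k\<^sup>2 \<le> card ?P" | "4 * k\<^sup>2 \<le> card ?N" using assms(4) by linarith
  then show ?thesis
  proof cases
    case 1
    have "\<exists>S\<subseteq>I. \<exists>J\<subseteq>X. card S = n \<and> card J = n \<and> (\<forall>i\<in>S. mono_on J (A i))"
      by (rule select[of ?P "\<lambda>l. l"]) (use 1 sub in \<open>auto simp: sign_pattern_def\<close>)
    then show ?thesis by blast
  next
    case 2
    have "\<exists>S\<subseteq>I. \<exists>J\<subseteq>X. card S = n \<and> card J = n \<and> (\<forall>i\<in>S. antimono_on J (A i))"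
    proof (rule select[of ?N "\<lambda>l. I - l"])
      fix t assume "t \<in> ?N"
      then show "I - ls ! t \<subseteq> I \<and> card I \<le> 2 * card (I - ls ! t)"
        using sub[of t] assms(1) by (auto simp: card_Diff_subset finite_subset)
    qed (use 2 in \<open>auto simp: sign_pattern_def reflp_def\<close>)
    then show ?thesis by blast
  qed
qed

text \<open>The parameters are \<open>q = 2 ^ (R + 1)\<close> from \<open>separated_pair\<close>,
  \<open>t = 8 * k ^ 2 - 1\<close>, and a depth \<open>D\<close> for which sparse words are
  outnumbered.\<close>

lemma monotone_rows:
  fixes A :: "'i \<Rightarrow> nat \<Rightarrow> 'b::linorder"
  assumes "finite I" "finite X" and R: "card I = 8 * n\<^sup>2" and "0 < k" "n \<le> 2 ^ k" "2 ^ k < 2 * n"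
    and X: "2 ^ ((card I + 1) * (32 * card I * k\<^sup>2)) \<le> card X"
  shows "\<exists>S\<subseteq>I. \<exists>J\<subseteq>X. card S = n \<and> card J = n \<and>
           ((\<forall>i\<in>S. mono_on J (A i)) \<or> (\<forall>i\<in>S. antimono_on J (A i)))"
proof -
  define R where "R = card I"
  \<comment> \<open>\<open>D\<close> is \<open>4 * R\<close> times the \<open>8 * k ^ 2\<close>
    levels wanted, because each factor \<open>1 + D * 2 ^ R\<close> of the sparse count is at most
    \<open>2 ^ (4 * R)\<close>.\<close>
  define D where "D = 32 * R * k\<^sup>2"
  have "k < 2 ^ k" by simp
  then have "k < 2 * n" using assms(6) by linarith
  have n2: "2 \<le> n"
  proof -
    have "(2::nat) ^ 1 \<le> 2 ^ k" using assms(4) by (intro power_increasing) auto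
    then show ?thesis using assms(6) by simp
  qed
  then have "2 ^ 2 \<le> n\<^sup>2" by (rule power_mono) simp
  then have R32: "32 \<le> R" using assms(3) by (simp add: R_def)
  have "k\<^sup>2 \<le> (2 * n)\<^sup>2" using \<open>k < 2 * n\<close> by (intro power_mono) auto
  then have "k\<^sup>2 \<le> R" using assms(3) by (simp add: R_def power_mult_distrib)
  have "(2::nat) ^ 5 \<le> 2 ^ R" using R32 by (intro power_increasing) auto
  have "D \<le> 32 * (R * R)" using \<open>k\<^sup>2 \<le> R\<close> unfolding D_def by (simp add: mult.assoc)
  also have "\<dots> < 2 ^ R * (2 ^ R * 2 ^ R)"
  proof (rule mult_le_less_imp_less)
    show "(32::nat) \<le> 2 ^ R" using \<open>(2::nat) ^ 5 \<le> 2 ^ R\<close> by simp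
    show "R * R < 2 ^ R * 2 ^ R" by (intro mult_strict_mono) auto
  qed (use R32 in auto)
  finally have "D < 2 ^ R * (2 ^ R * 2 ^ R)" .
  then have "Suc D * 2 ^ R \<le> (2 ^ R * (2 ^ R * 2 ^ R)) * 2 ^ R" by (intro mult_right_mono) auto
  moreover have "1 + D * 2 ^ R \<le> Suc D * 2 ^ R" by simp
  ultimately have "1 + D * 2 ^ R \<le> (2 ^ R * (2 ^ R * 2 ^ R)) * 2 ^ R" by (rule order_trans[rotated])
  also have "\<dots> = (2 ^ R) ^ 4" by (simp add: power4_eq_xxxx)
  finally have base: "1 + D * card (Pow I) \<le> 2 ^ (4 * R)"
    using assms(1) by (simp add: card_Pow R_def power_mult[symmetric] mult.commute)
  have k2: "0 < k\<^sup>2" using assms(4) by simp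
  have "(1 + D * card (Pow I)) ^ (8 * k\<^sup>2 - 1) \<le> (2 ^ (4 * R)) ^ (8 * k\<^sup>2 - 1)"
    using base by (rule power_mono) simp
  also have "\<dots> = 2 ^ (4 * R * (8 * k\<^sup>2 - 1))" by (simp add: power_mult)
  also have "\<dots> < 2 ^ D"
  proof (rule power_strict_increasing)
    have "4 * R * (8 * k\<^sup>2 - 1) < 4 * R * (8 * k\<^sup>2)"
      using R32 k2 by (intro mult_strict_left_mono) auto
    then show "4 * R * (8 * k\<^sup>2 - 1) < D" by (simp add: D_def)
  qed simp
  finally have count: "(1 + D * card (Pow I)) ^ (8 * k\<^sup>2 - 1) < 2 ^ D" .
  have "\<exists>ls. set ls \<subseteq> Pow I \<and> 8 * k\<^sup>2 - 1 < length ls \<and> split_tree (sign_pattern I A) ls X"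
  proof (rule long_split_tree[where q = "2 ^ (card I + 1)" and D = D])
    show "(2 ^ (card I + 1)) ^ D \<le> card X"
      using X by (simp only: power_mult[symmetric] D_def R_def)
    show "\<exists>L\<subseteq>Y. \<exists>R\<subseteq>Y. \<exists>s\<in>Pow I. m \<le> card L \<and> m \<le> card R \<and>
            (\<forall>a\<in>L. \<forall>b\<in>R. a < b \<and> sign_pattern I A s a b)"
      if "finite Y" "2 ^ (card I + 1) * m \<le> card Y" for Y m
      using separated_pair[OF assms(1) that, of A] by (simp only: Bex_def Pow_iff)
  qed (use assms count in auto)
  then obtain ls where ls: "set ls \<subseteq> Pow I" "8 * k\<^sup>2 - 1 < length ls" "split_tree (sign_pattern I A) ls X"
    by blast
  \<comment> \<open>From \<open>2 ^ k < 2 * n\<close> the requirement of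
    \<open>common_elements\<close> is at most \<open>4 * n ^ 2\<close>, within the
    \<open>8 * n ^ 2\<close> rows.\<close>
  have "n * 2 ^ (k + 1) \<le> n * (4 * n)" using assms(6) by (intro mult_left_mono) auto
  also have "\<dots> \<le> card I" using R by (simp add: power2_eq_square)
  finally show ?thesis
    using split_tree_monotone_rows[OF assms(1) ls(3,1), of k n] ls(2) assms n2 by simp
qed

subsection \<open>Columns that order the rows alike\<close>

text \<open>Ranks record the weak order of the entries in a column, ties included, by numbers below
  \<open>dim_row A\<close>; this bounds the number of orders by \<open>m ^ m\<close>.\<close>

definition column_rank :: "real mat \<Rightarrow> nat \<Rightarrow> nat \<Rightarrow> nat" where
  "column_rank A j i = card {i'. i' < dim_row A \<and> A $$ (i', j) < A $$ (i, j)}"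

lemma column_rank_less: "i < dim_row A \<Longrightarrow> column_rank A j i < dim_row A"
proof -
  assume "i < dim_row A"
  then have "{i'. i' < dim_row A \<and> A $$ (i', j) < A $$ (i, j)} \<subset> {..<dim_row A}" by auto
  then show ?thesis unfolding column_rank_def by (metis card_lessThan finite_lessThan psubset_card_mono)
qed

text \<open>For the converse: if the entry at \<open>i'\<close> is smaller, then \<open>i'\<close>
  is counted for \<open>i\<close> but not for itself, so its rank is strictly smaller.\<close>

lemma column_rank_le_iff:
  assumes "i < dim_row A" "i' < dim_row A"
  shows "column_rank A j i \<le> column_rank A j i' \<longleftrightarrow> A $$ (i, j) \<le> A $$ (i', j)"
proof
  assume "A $$ (i, j) \<le> A $$ (i', j)"
  then show "column_rank A j i \<le> column_rank A j i'"
    unfolding column_rank_def by (intro card_mono) auto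
next
  assume *: "column_rank A j i \<le> column_rank A j i'"
  show "A $$ (i, j) \<le> A $$ (i', j)"
  proof (rule ccontr)
    assume "\<not> A $$ (i, j) \<le> A $$ (i', j)"
    then have "i' \<in> {l. l < dim_row A \<and> A $$ (l, j) < A $$ (i, j)}"
      "{l. l < dim_row A \<and> A $$ (l, j) < A $$ (i', j)} \<subseteq> {l. l < dim_row A \<and> A $$ (l, j) < A $$ (i, j)}"
      using assms(2) by auto
    then have "{l. l < dim_row A \<and> A $$ (l, j) < A $$ (i', j)} \<subset>
        {l. l < dim_row A \<and> A $$ (l, j) < A $$ (i, j)}"
      by (rule_tac psubsetI) blast+
    then have "column_rank A j i' < column_rank A j i"
      unfolding column_rank_def by (intro psubset_card_mono) auto
    then show False using * by simp
  qed
qed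

text \<open>Pigeonhole over the rank functions; \<open>f\<close> is the common one, so monotonicity
  of \<open>f\<close> on a set of rows transfers to all columns in \<open>X\<close>.\<close>

lemma equally_ordered_columns:
  fixes A :: "real mat"
  assumes "0 < dim_row A" "dim_row A ^ dim_row A * M \<le> dim_col A"
  shows "\<exists>f. \<exists>X\<subseteq>{..<dim_col A}. M \<le> card X \<and>
    (\<forall>j\<in>X. \<forall>i<dim_row A. \<forall>i'<dim_row A. (f i :: nat) \<le> f i' \<longleftrightarrow> A $$ (i, j) \<le> A $$ (i', j))"
proof -
  define m where "m = dim_row A"
  define \<phi> where "\<phi> j = restrict (column_rank A j) {..<m}" for j
  define T where "T = PiE {..<m} (\<lambda>_. {..<m})"
  have "\<phi> \<in> {..<dim_col A} \<rightarrow> T"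
    unfolding \<phi>_def T_def m_def using column_rank_less by auto
  moreover have T: "finite T" "card T = m ^ m"
    unfolding T_def by (auto simp: card_PiE intro: finite_PiE)
  moreover have "T \<noteq> {}" using T assms(1) by (auto simp: m_def)
  ultimately obtain f where f: "dim_col A \<le> card (\<phi> -` {f} \<inter> {..<dim_col A}) * m ^ m"
    using pigeonhole_card[of \<phi> "{..<dim_col A}" T] by auto
  let ?X = "\<phi> -` {f} \<inter> {..<dim_col A}"
  have "m ^ m * M \<le> dim_col A" using assms(2) by (simp only: m_def)
  also have "\<dots> \<le> m ^ m * card ?X" using f by (simp only: mult.commute)
  finally have "m ^ m * M \<le> m ^ m * card ?X" .
  moreover have "0 < m ^ m" using assms(1) by (simp add: m_def)
  ultimately have "M \<le> card ?X" by (simp only: mult_le_cancel1)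
  moreover have "f i \<le> f i' \<longleftrightarrow> A $$ (i, j) \<le> A $$ (i', j)"
    if "j \<in> ?X" "i < dim_row A" "i' < dim_row A" for i i' j
  proof -
    have "f = \<phi> j" using that by auto
    then show ?thesis using column_rank_le_iff that by (simp add: \<phi>_def m_def)
  qed
  ultimately show ?thesis by (intro exI[of _ f] exI[of _ ?X]) auto
qed

subsection \<open>Monotone submatrices\<close>

lemma monotone_mat_submatrix:
  assumes I: "I \<subseteq> {..<dim_row A}" and J: "J \<subseteq> {..<dim_col A}"
    and rows: "(\<forall>i\<in>I. mono_on J (\<lambda>j. A $$ (i, j))) \<or> (\<forall>i\<in>I. antimono_on J (\<lambda>j. A $$ (i, j)))"
    and cols: "(\<forall>j\<in>J. mono_on I (\<lambda>i. A $$ (i, j))) \<or> (\<forall>j\<in>J. antimono_on I (\<lambda>i. A $$ (i, j)))"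
  shows "monotone_mat (submatrix A I J)"
proof -
  \<comment> \<open>\<open>submatrix\<close> counts only indices within the dimensions, which here
    means all of \<open>I\<close> and \<open>J\<close>.\<close>
  have eq: "{i. i < dim_row A \<and> i \<in> I} = I" "{j. j < dim_col A \<and> j \<in> J} = J" using I J by auto
  then have dims: "dim_row (submatrix A I J) = card I" "dim_col (submatrix A I J) = card J"
    by (simp_all add: dim_submatrix)
  have entry: "submatrix A I J $$ (i, j) = A $$ (pick I i, pick J j)" if "i < card I" "j < card J" for i j
    using that eq by (simp add: submatrix_index)
  have pick_le: "pick S x \<le> pick S y" if "y < card S" "x \<le> y" for S x y
    using pick_mono_le[of y S x] that by (cases "x = y") auto
  note pick_in_set_le[simp]
  have row: "monotone_on {..<card J} (\<le>) r (\<lambda>j. submatrix A I J $$ (i, j))"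
    if "\<forall>i\<in>I. monotone_on J (\<le>) r (\<lambda>j. A $$ (i, j))" "i < card I" for r i
  proof (rule monotone_onI)
    fix x y assume "x \<in> {..<card J}" "y \<in> {..<card J}" "x \<le> y"
    then show "r (submatrix A I J $$ (i, x)) (submatrix A I J $$ (i, y))"
      using that pick_le[of y J x] by (auto simp: entry intro!: monotone_onD[of J "(\<le>)" r])
  qed
  have col: "monotone_on {..<card I} (\<le>) r (\<lambda>i. submatrix A I J $$ (i, j))"
    if "\<forall>j\<in>J. monotone_on I (\<le>) r (\<lambda>i. A $$ (i, j))" "j < card J" for r j
  proof (rule monotone_onI)
    fix x y assume "x \<in> {..<card I}" "y \<in> {..<card I}" "x \<le> y"
    then show "r (submatrix A I J $$ (x, j)) (submatrix A I J $$ (y, j))"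
      using that pick_le[of y I x] by (auto simp: entry intro!: monotone_onD[of I "(\<le>)" r])
  qed
  show ?thesis unfolding monotone_mat_def dims using rows cols row col by blast
qed

section \<open>Assembly and the number of columns\<close>

text \<open>\<open>k\<close> is the logarithm of \<open>n\<close> rounded up;
  \<open>1 \<le> log 2 n\<close> absorbs the rounding into the factor 2.\<close>

lemma log_power_bounds:
  fixes n :: nat
  assumes "2 \<le> n"
  shows "\<exists>k. 0 < k \<and> n \<le> 2 ^ k \<and> 2 ^ k < 2 * n \<and> real k \<le> 2 * log 2 n"
proof -
  define k where "k = (LEAST k. n \<le> 2 ^ k)"
  have "n \<le> 2 ^ n" by (simp add: less_imp_le)
  then have k: "n \<le> 2 ^ k" unfolding k_def by (rule LeastI)
  have "k \<noteq> 0" using k assms by (cases k) auto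
  then have "\<not> n \<le> 2 ^ (k - 1)" unfolding k_def by (intro not_less_Least) auto
  then have k': "2 ^ k < 2 * n" using \<open>k \<noteq> 0\<close> by (cases k) auto
  have "real (2 ^ k) < real (2 * n)" using k' by (rule of_nat_less_iff[THEN iffD2])
  then have "log 2 (2 ^ k) < log 2 (2 * real n)" by (intro log_less) auto
  then have "real k < 1 + log 2 n" using assms by (simp add: log_mult log_nat_power)
  moreover have "1 \<le> log 2 n" using assms by simp
  ultimately have "real k \<le> 2 * log 2 n" by linarith
  then show ?thesis using k k' \<open>k \<noteq> 0\<close> by (intro exI[of _ k]) auto
qed

lemma has_monotone_submatrix_if_large:
  assumes n: "2 \<le> n" and m: "dim_row A = 64 * n ^ 4"
    and k: "0 < k" "n \<le> 2 ^ k" "2 ^ k < 2 * n"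
    and N: "(64 * n ^ 4) ^ (64 * n ^ 4) * 2 ^ ((8 * n\<^sup>2 + 1) * (32 * (8 * n\<^sup>2) * k\<^sup>2)) \<le> dim_col A"
  shows "has_monotone_submatrix n A"
proof -
  define M :: nat where "M = 2 ^ ((8 * n\<^sup>2 + 1) * (32 * (8 * n\<^sup>2) * k\<^sup>2))"
  have "0 < dim_row A" using m n by simp
  moreover have "dim_row A ^ dim_row A * M \<le> dim_col A" using N by (simp only: m M_def)
  ultimately obtain f X where X: "X \<subseteq> {..<dim_col A}" "M \<le> card X"
    "\<And>i i' j. j \<in> X \<Longrightarrow> i < dim_row A \<Longrightarrow> i' < dim_row A \<Longrightarrow>
       (f i :: nat) \<le> f i' \<longleftrightarrow> A $$ (i, j) \<le> A $$ (i', j)"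
    using equally_ordered_columns[of A M] by blast
  \<comment> \<open>The row count \<open>64 * n ^ 4\<close> is the square of
    \<open>8 * n ^ 2 = Suc a\<close>, hence exceeds \<open>a * a\<close>.\<close>
  define a where "a = 8 * n\<^sup>2 - 1"
  have a: "Suc a = 8 * n\<^sup>2" using n by (simp add: a_def)
  have "a * a < Suc a * Suc a" by simp
  also have "\<dots> = dim_row A" unfolding a m by (simp add: power2_eq_square power4_eq_xxxx)
  finally obtain I where I: "I \<subseteq> {..<dim_row A}" "card I = 8 * n\<^sup>2" "mono_on I f \<or> antimono_on I f"
    using erdos_szekeres[of a a "dim_row A" f] unfolding a by blast
  have finI: "finite I" and finX: "finite X" using I(1) X(1) finite_subset by auto
  obtain S J where SJ: "S \<subseteq> I" "J \<subseteq> X" "card S = n" "card J = n"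
    "(\<forall>i\<in>S. mono_on J (\<lambda>j. A $$ (i, j))) \<or> (\<forall>i\<in>S. antimono_on J (\<lambda>j. A $$ (i, j)))"
    using monotone_rows[OF finI finX I(2) k, of "\<lambda>i j. A $$ (i, j)"] X(2) unfolding I(2) M_def by blast
  have iff: "f i \<le> f i' \<longleftrightarrow> A $$ (i, j) \<le> A $$ (i', j)" if "j \<in> J" "i \<in> S" "i' \<in> S" for i i' j
    using X(3) that SJ(1,2) I(1) by blast
  have "(\<forall>j\<in>J. mono_on S (\<lambda>i. A $$ (i, j))) \<or> (\<forall>j\<in>J. antimono_on S (\<lambda>i. A $$ (i, j)))"
    using I(3)
  proof
    assume "mono_on I f"
    then have "mono_on S f" using SJ(1) by (rule monotone_on_subset)
    then show ?thesis by (intro disjI1) (auto simp: monotone_on_def iff[symmetric])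
  next
    assume "antimono_on I f"
    then have "antimono_on S f" using SJ(1) by (rule monotone_on_subset)
    then show ?thesis by (intro disjI2) (auto simp: monotone_on_def iff[symmetric])
  qed
  then have "monotone_mat (submatrix A S J)"
    using SJ I(1) X(1) by (intro monotone_mat_submatrix) auto
  then show ?thesis
    unfolding has_monotone_submatrix_def using SJ I(1) X(1) by (intro exI[of _ S] exI[of _ J]) auto
qed

text \<open>With \<open>l = log 2 n\<close>, the column orders cost an exponent of at most
  \<open>640 * n ^ 4 * l ^ 2\<close>, and the tree at most \<open>16384 * n ^ 4 * l ^ 2\<close>;
  20000 exceeds the sum of the coefficients.\<close>

lemma column_bound:
  fixes n k :: nat
  assumes n: "2 \<le> n" and k: "real k \<le> 2 * log 2 n"
  shows "real ((64 * n ^ 4) ^ (64 * n ^ 4) * 2 ^ ((8 * n\<^sup>2 + 1) * (32 * (8 * n\<^sup>2) * k\<^sup>2)))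
    \<le> 2 powr (20000 * real n ^ 4 * (log 2 n)\<^sup>2)"
proof -
  define l where "l = log 2 n"
  have l: "1 \<le> l" using n by (simp add: l_def)
  then have l2: "l \<le> l\<^sup>2" "1 \<le> l\<^sup>2" by (auto simp: power2_eq_square intro: order_trans[OF l])
  have npos: "0 < real n" using n by simp
  have nl: "real n = 2 powr l" using npos by (simp add: l_def)
  have "real (64 * n ^ 4) = 2 powr 6 * (2 powr l) ^ 4" by (simp flip: nl)
  also have "\<dots> = 2 powr (6 + 4 * l)" by (simp add: powr_add powr_realpow[symmetric] powr_powr mult.commute)
  finally have m: "real (64 * n ^ 4) = 2 powr (6 + 4 * l)" .
  have "real ((64 * n ^ 4) ^ (64 * n ^ 4)) = (2 powr (6 + 4 * l)) powr real (64 * n ^ 4)"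
    unfolding m[symmetric] using n by (subst powr_realpow) auto
  also have "\<dots> = 2 powr (64 * real n ^ 4 * (6 + 4 * l))"
    by (simp add: powr_powr mult.commute)
  finally have 1: "real ((64 * n ^ 4) ^ (64 * n ^ 4)) = 2 powr (64 * real n ^ 4 * (6 + 4 * l))" .
  have 2: "real (2 ^ e) = 2 powr real e" for e by (simp add: powr_realpow)
  have "real k ^ 2 \<le> (2 * l)\<^sup>2" using k by (intro power_mono) (auto simp: l_def)
  then have k2: "(real k)\<^sup>2 \<le> 4 * l\<^sup>2" by (simp add: power_mult_distrib)
  have "1 \<le> (real n)\<^sup>2" using n by simp
  then have n2: "8 * (real n)\<^sup>2 + 1 \<le> 16 * (real n)\<^sup>2" by linarith
  have "real ((8 * n\<^sup>2 + 1) * (32 * (8 * n\<^sup>2) * k\<^sup>2)) = (8 * (real n)\<^sup>2 + 1) * (256 * (real n)\<^sup>2 * (real k)\<^sup>2)"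
    by (simp add: algebra_simps)
  also have "\<dots> \<le> (16 * (real n)\<^sup>2) * (256 * (real n)\<^sup>2 * (real k)\<^sup>2)"
    using n2 by (rule mult_right_mono) simp
  also have "\<dots> = 4096 * real n ^ 4 * (real k)\<^sup>2" by (simp add: power2_eq_square power4_eq_xxxx)
  also have "\<dots> \<le> 4096 * real n ^ 4 * (4 * l\<^sup>2)" using k2 by (intro mult_left_mono) auto
  finally have 3: "real ((8 * n\<^sup>2 + 1) * (32 * (8 * n\<^sup>2) * k\<^sup>2)) \<le> real n ^ 4 * (16384 * l\<^sup>2)" by simp
  have "64 * real n ^ 4 * (6 + 4 * l) = real n ^ 4 * (384 + 256 * l)" by simp
  also have "\<dots> \<le> real n ^ 4 * (640 * l\<^sup>2)" using l2 by (intro mult_left_mono) auto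
  finally have "64 * real n ^ 4 * (6 + 4 * l) + real ((8 * n\<^sup>2 + 1) * (32 * (8 * n\<^sup>2) * k\<^sup>2))
      \<le> real n ^ 4 * (640 * l\<^sup>2) + real n ^ 4 * (16384 * l\<^sup>2)" using 3 by linarith
  also have "\<dots> \<le> 20000 * real n ^ 4 * l\<^sup>2" by simp
  finally have "2 powr (64 * real n ^ 4 * (6 + 4 * l)) * 2 powr real ((8 * n\<^sup>2 + 1) * (32 * (8 * n\<^sup>2) * k\<^sup>2))
      \<le> 2 powr (20000 * real n ^ 4 * l\<^sup>2)"
    unfolding powr_add[symmetric] by (intro powr_mono) auto
  then show ?thesis unfolding of_nat_mult 1 2 l_def[symmetric] .
qed

text \<open>The case \<open>n = 1\<close> stands apart: \<open>log 2 1 = 0\<close> leaves a single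
  column, and one entry suffices.\<close>

lemma has_monotone_submatrix_1:
  assumes "0 < dim_row A" "0 < dim_col A"
  shows "has_monotone_submatrix 1 A"
  unfolding has_monotone_submatrix_def
  using assms by (intro exI[of _ "{0}"] conjI monotone_mat_submatrix) (auto simp: monotone_on_def)

theorem theorem5:
  "\<exists>c\<^sub>0::real. c\<^sub>0 > 0 \<and>
     (\<forall>n::nat. n \<ge> 1 \<longrightarrow>
       (\<forall>A::real mat.
          A \<in> carrier_mat (64 * n ^ 4)
                 (nat \<lceil>2 powr (c\<^sub>0 * real n ^ 4 * (log 2 (real n))\<^sup>2)\<rceil>) \<longrightarrow>
          has_monotone_submatrix n A))"
proof (intro exI[of _ 20000] conjI allI impI)
  fix n :: nat and A :: "real mat"
  assume n: "1 \<le> n"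
    and A: "A \<in> carrier_mat (64 * n ^ 4) (nat \<lceil>2 powr (20000 * real n ^ 4 * (log 2 (real n))\<^sup>2)\<rceil>)"
  show "has_monotone_submatrix n A"
  proof (cases "n = 1")
    case True
    then show ?thesis using A has_monotone_submatrix_1[of A] by auto
  next
    case False
    then have "2 \<le> n" using n by simp
    then obtain k where k: "0 < k" "n \<le> 2 ^ k" "2 ^ k < 2 * n" "real k \<le> 2 * log 2 n"
      using log_power_bounds by blast
    show ?thesis
    proof (rule has_monotone_submatrix_if_large[OF \<open>2 \<le> n\<close> _ k(1-3)])
      \<comment> \<open>The comparison is made in the reals, where rounding up the number of columns
        only helps.\<close>
      have "real ((64 * n ^ 4) ^ (64 * n ^ 4) * 2 ^ ((8 * n\<^sup>2 + 1) * (32 * (8 * n\<^sup>2) * k\<^sup>2)))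
          \<le> real (dim_col A)"
        using column_bound[OF \<open>2 \<le> n\<close> k(4)] A real_nat_ceiling_ge by (auto intro: order_trans)
      then show "(64 * n ^ 4) ^ (64 * n ^ 4) * 2 ^ ((8 * n\<^sup>2 + 1) * (32 * (8 * n\<^sup>2) * k\<^sup>2)) \<le> dim_col A"
        by (simp only: of_nat_le_iff)
    qed (use A in auto)
  qed
qed simp

end
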